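(* Let $\mathcal{E}$ be the edge set of a connected graph without loops on a finite set of $N_{\mathrm{tot}}$ qubits, and let $J\neq 0$ be a real number. Then, as operators on $(\mathbb{C}^2)^{\otimes N_{\mathrm{tot}}}$, $$\Delta\vec{S}^2\;\le\; N_{\mathrm{tot}}\,(N_{\mathrm{tot}}-1)^2\;\frac{\Delta H}{4J}.$$
   Context: Each vertex $i$ of the graph carries a qubit $\mathbb{C}^2$ with Pauli vector $\vec{\sigma}_i=(\sigma_i^{\mathrm{x}},\sigma_i^{\mathrm{y}},\sigma_i^{\mathrm{z}})$ (acting as the identity on the other qubits), and $\vec\sigma_i\cdot\vec\sigma_k=\sigma_i^{\mathrm{x}}\sigma_k^{\mathrm{x}}+\sigma_i^{\mathrm{y}}\sigma_k^{\mathrm{y}}+\sigma_i^{\mathrm{z}}\sigma_k^{\mathrm{z}}$. The Heisenberg Hamiltonian is $H=-J\sum_{(i,k)\in\mathcal{E}}\vec{\sigma}_i\cdot\vec{\sigma}_k$, where each edge of the (undirected) graph is counted once. Put $E_*=-J|\mathcal{E}|$ and $\Delta H=H-E_* I=-J\sum_{(i,k)\in\mathcal{E}}(\vec\sigma_i\cdot\vec\sigma_k-I)$. The total spin is $\vec{S}=\sum_i\vec{\sigma}_i/2$, so that $\vec{S}^2=\frac14\sum_i\sum_k\vec\sigma_i\cdot\vec\sigma_k$, and $\Delta\vec{S}^2=\frac{N_{\mathrm{tot}}}{2}\left(\frac{N_{\mathrm{tot}}}{2}+1\right)I-\vec{S}^2$. For Hermitian operators $A,B$, $A\le B$ means that $B-A$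 is positive semidefinite. *)

theory Defs
  imports "HOL-Analysis.Analysis"
begin

text \<open>
  Vertices are the elements of a finite type \<open>'v\<close>, so the number of qubits is \<open>CARD('v)\<close>.  The
  computational basis of a qubit is indexed by \<open>bool\<close>, with \<open>True\<close> for the first basis vector
  (spin up); the product basis of the tensor power is therefore indexed by \<open>'v \<Rightarrow> bool\<close>.
\<close>

type_synonym qubit_op = "complex ^ bool ^ bool"
type_synonym 'v op = "complex ^ ('v \<Rightarrow> bool) ^ ('v \<Rightarrow> bool)"

definition pauli_x :: qubit_op where
  "pauli_x = (\<chi> s t. if s = t then 0 else 1)"

definition pauli_y :: qubit_op where
  "pauli_y = (\<chi> s t. if s = t then 0 else if s then - \<i> else \<i>)"

definition pauli_z :: qubit_op where
  "pauli_z = (\<chi> s t. if s = t then (if s then 1 else - 1) else 0)"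

definition tensor_op :: "('v \<Rightarrow> qubit_op) \<Rightarrow> ('v::finite) op" where
  "tensor_op M = (\<chi> s t. \<Prod>j\<in>UNIV. M j $ s j $ t j)"

definition site_op :: "'v \<Rightarrow> qubit_op \<Rightarrow> ('v::finite) op" where
  "site_op i P = tensor_op (\<lambda>j. if j = i then P else mat 1)"

definition sigma_dot :: "'v \<Rightarrow> 'v \<Rightarrow> ('v::finite) op" where
  "sigma_dot i k =
     site_op i pauli_x ** site_op k pauli_x +
     site_op i pauli_y ** site_op k pauli_y +
     site_op i pauli_z ** site_op k pauli_z"

text \<open>
  An edge is an unordered pair \<open>{i, k}\<close>.  Its interaction term is well defined because
  \<open>sigma_dot\<close> is symmetric; see \<open>edge_op_eq\<close> below.
\<close>

definition loopless_graph :: "'v set set \<Rightarrow> bool" where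
  "loopless_graph E \<longleftrightarrow> (\<forall>e\<in>E. \<exists>i k. i \<noteq> k \<and> e = {i, k})"

definition connected_graph :: "'v set set \<Rightarrow> bool" where
  "connected_graph E \<longleftrightarrow> (\<forall>i k. (i, k) \<in> {(a, b). {a, b} \<in> E}\<^sup>*)"

definition edge_op :: "'v set \<Rightarrow> ('v::finite) op" where
  "edge_op e = (THE A. \<exists>i k. e = {i, k} \<and> A = sigma_dot i k)"

definition heisenberg :: "real \<Rightarrow> 'v set set \<Rightarrow> ('v::finite) op" where
  "heisenberg J E = (- J) *\<^sub>R (\<Sum>e\<in>E. edge_op e)"

definition E_star :: "real \<Rightarrow> 'v set set \<Rightarrow> real" where
  "E_star J E = - J * real (card E)"

definition Delta_H :: "real \<Rightarrow> 'v set set \<Rightarrow> ('v::finite) op" where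
  "Delta_H J E = heisenberg J E - E_star J E *\<^sub>R mat 1"

definition total_spin :: "qubit_op \<Rightarrow> ('v::finite) op" where
  "total_spin P = (\<Sum>i\<in>UNIV. (1/2) *\<^sub>R site_op i P)"

definition total_spin_sq :: "('v::finite) op" where
  "total_spin_sq =
     total_spin pauli_x ** total_spin pauli_x +
     total_spin pauli_y ** total_spin pauli_y +
     total_spin pauli_z ** total_spin pauli_z"

definition Delta_S_sq :: "('v::finite) op" where
  "Delta_S_sq =
     (real CARD('v) / 2 * (real CARD('v) / 2 + 1)) *\<^sub>R mat 1 - total_spin_sq"

definition hermitian :: "complex ^ 'n ^ 'n \<Rightarrow> bool" where
  "hermitian A \<longleftrightarrow> (\<forall>s t. A $ s $ t = cnj (A $ t $ s))"

definition pos_semidef :: "complex ^ 'n ^ 'n \<Rightarrow> bool" where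
  "pos_semidef A \<longleftrightarrow>
     hermitian A \<and> (\<forall>v. 0 \<le> Re (\<Sum>s\<in>UNIV. cnj (v $ s) * (A *v v) $ s))"

definition op_le :: "complex ^ 'n ^ 'n \<Rightarrow> complex ^ 'n ^ 'n \<Rightarrow> bool"  (infix \<open>\<preceq>\<close> 50) where
  "A \<preceq> B \<longleftrightarrow> hermitian A \<and> hermitian B \<and> pos_semidef (B - A)"

lemma tensor_op_mult: "tensor_op M ** tensor_op N = tensor_op (\<lambda>j. M j ** N j)"
proof -
  have "(\<Sum>u\<in>UNIV. (\<Prod>j\<in>UNIV. M j $ s j $ u j) * (\<Prod>j\<in>UNIV. N j $ u j $ t j)) =
        (\<Prod>j\<in>UNIV. \<Sum>b\<in>UNIV. M j $ s j $ b * N j $ b $ t j)" for s t :: "'a \<Rightarrow> bool"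
    by (subst prod_sum_PiE) (simp_all add: prod.distrib PiE_UNIV_domain)
  then show ?thesis
    by (simp add: tensor_op_def matrix_matrix_mult_def vec_eq_iff)
qed

lemma site_op_commute:
  assumes "i \<noteq> k"
  shows "site_op i P ** site_op k Q = site_op k Q ** site_op i P"
proof -
  have "(\<lambda>j. (if j = i then P else mat 1) ** (if j = k then Q else mat 1)) =
        (\<lambda>j. (if j = k then Q else mat 1) ** (if j = i then P else mat 1))"
    using assms by auto
  then show ?thesis
    by (simp add: site_op_def tensor_op_mult)
qed

lemma sigma_dot_commute: "sigma_dot i k = sigma_dot k i"
  by (cases "i = k") (simp_all add: sigma_dot_def site_op_commute)

lemma edge_op_eq: "edge_op {i, k} = sigma_dot i k"
  unfolding edge_op_def
  by (rule the_equality) (auto simp: doubleton_eq_iff sigma_dot_commute)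

end

(*
  Let P_ik be the operator exchanging the qubits i and k. Since sigma_i . sigma_k = 2 P_ik - I for
  i and k distinct, Delta S^2 is half the sum of I - P_ik over all ordered pairs, and Delta H / (4 J)
  is half the sum of I - P_ik over the edges. For a fixed vector v, the number |v - P_ik v| is a
  pseudometric in (i, k); this uses that a qubit has only two levels. Along a path without repeated
  vertices, which has at most N - 1 edges, the triangle inequality and Cauchy-Schwarz bound
  |v - P_ik v|^2 by N - 1 times the sum over the edges of E. Summing over the N (N - 1) ordered
  pairs gives the constant N (N - 1)^2.
*)

theory Submission
  imports Defs "HOL-Library.Transitive_Closure_Table"
begin

section \<open>Exchange of two qubits\<close>

definition swap_config :: "'v \<Rightarrow> 'v \<Rightarrow> ('v \<Rightarrow> bool) \<Rightarrow> 'v \<Rightarrow> bool" where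
  "swap_config i k s = s(i := s k, k := s i)"

text \<open>A permutation matrix. Since \<open>swap_config i k\<close> is an involution, permuting
  rows or permuting columns gives the same matrix.\<close>

definition swap_op :: "'v \<Rightarrow> 'v \<Rightarrow> ('v::finite) op" where
  "swap_op i k = (\<chi> s t. if t = swap_config i k s then 1 else 0)"

lemma swap_config_involution [simp]: "swap_config i k (swap_config i k s) = s"
  by (auto simp: swap_config_def)

lemma swap_config_same [simp]: "swap_config i i s = s"
  by (auto simp: swap_config_def)

lemma swap_config_apply:
  "swap_config i k s j = (if j = k then s i else if j = i then s k else s j)"
  by (simp add: swap_config_def)

text \<open>The two exchanges together rotate three values: \<open>i\<close> receives
  \<open>s j\<close>, \<open>j\<close> receives \<open>s k\<close>, and \<open>k\<close> receives
  \<open>s i\<close>. If \<open>s j = s k\<close>, this is the exchange of \<open>i\<close> and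
  \<open>k\<close>.\<close>

lemma swap_config_detour:
  assumes "i \<noteq> j" "j \<noteq> k" "i \<noteq> k" "s j = s k"
  shows "swap_config k j (swap_config j i s) = swap_config i k s"
  using assms by (intro ext) (simp add: swap_config_apply)

lemma swap_config_commute: "swap_config i k s = swap_config k i s"
  by (simp add: fun_eq_iff swap_config_apply)

lemma swap_config_eq_self: "s i = s k \<Longrightarrow> swap_config i k s = s"
  by (simp add: fun_eq_iff swap_config_apply)

lemma bij_swap_config: "bij (swap_config i k)"
  by (rule o_bij[of "swap_config i k"]) auto

lemma swap_op_same [simp]: "swap_op i i = mat 1"
  by (auto simp: swap_op_def mat_def vec_eq_iff)

lemma swap_op_mult_vec: "(swap_op i k *v v) $ s = v $ swap_config i k s"
proof -
  have "(swap_op i k *v v) $ s = (\<Sum>t\<in>UNIV. if t = swap_config i k s then v $ t else 0)"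
    unfolding swap_op_def matrix_vector_mult_def vec_lambda_beta by (rule sum.cong) auto
  then show ?thesis by simp
qed

section \<open>Pauli products as exchange operators\<close>

lemma tensor_op_mat_1: "tensor_op (\<lambda>j. mat 1) = (mat 1 :: ('v::finite) op)"
proof -
  have "(\<Prod>j\<in>UNIV. (mat 1 :: qubit_op) $ s j $ t j) = (if s = t then 1 else 0)" for s t :: "'v \<Rightarrow> bool"
  proof (cases "s = t")
    case False
    then obtain j where "s j \<noteq> t j" by auto
    then show ?thesis using False by (auto simp: mat_def intro!: prod_zero)
  qed (simp add: mat_def)
  then show ?thesis by (simp add: tensor_op_def vec_eq_iff mat_def)
qed

lemma site_op_same_mult: "site_op i P ** site_op i Q = site_op i (P ** Q)"
  unfolding site_op_def tensor_op_mult by (rule arg_cong[of _ _ tensor_op]) auto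

lemma site_op_mat_1: "site_op i (mat 1) = mat 1"
  by (simp add: site_op_def tensor_op_mat_1 cong: if_cong)

lemma pauli_squares:
  "pauli_x ** pauli_x = mat 1" "pauli_y ** pauli_y = mat 1" "pauli_z ** pauli_z = mat 1"
  by (auto simp: pauli_x_def pauli_y_def pauli_z_def matrix_matrix_mult_def mat_def vec_eq_iff UNIV_bool)

lemma sigma_dot_same: "sigma_dot i i = 3 *\<^sub>R mat 1"
  unfolding sigma_dot_def site_op_same_mult pauli_squares site_op_mat_1
  by (simp add: vec_eq_iff scaleR_conv_of_real[where 'a = complex])

text \<open>The factors away from \<open>i\<close> and \<open>k\<close> are identity matrices, and a
  single off-diagonal zero among them kills the product.\<close>

lemma two_site_op_entry:
  assumes "i \<noteq> k"
  shows "(site_op i P ** site_op k Q) $ s $ t =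
    (if \<forall>j. j \<noteq> i \<longrightarrow> j \<noteq> k \<longrightarrow> s j = t j then P $ s i $ t i * Q $ s k $ t k else 0)"
proof -
  let ?M = "\<lambda>j. (if j = i then P else mat 1) ** (if j = k then Q else mat 1)"
  have UNIV_eq: "(UNIV :: 'a set) = insert i (insert k (- {i, k}))" by auto
  have "(\<Prod>j\<in>UNIV. ?M j $ s j $ t j) =
      P $ s i $ t i * Q $ s k $ t k * (\<Prod>j\<in>- {i, k}. ?M j $ s j $ t j)"
    using assms by (subst UNIV_eq) (simp add: mult.assoc)
  also have "(\<Prod>j\<in>- {i, k}. ?M j $ s j $ t j) = (\<Prod>j\<in>- {i, k}. if s j = t j then 1 else 0)"
    by (rule prod.cong) (simp_all, simp add: mat_def)
  also have "\<dots> = (if \<forall>j. j \<noteq> i \<longrightarrow> j \<noteq> k \<longrightarrow> s j = t j then 1 else 0)"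
    by (auto intro: prod_zero)
  finally show ?thesis
    unfolding site_op_def tensor_op_mult by (auto simp: tensor_op_def)
qed

text \<open>The matrix entries of sigma . sigma = 2 P - I on two qubits, with row index
  \<open>(a, c)\<close>, column index \<open>(b, d)\<close> and exchange P.\<close>

lemma pauli_exchange:
  "pauli_x $ a $ b * pauli_x $ c $ d + pauli_y $ a $ b * pauli_y $ c $ d + pauli_z $ a $ b * pauli_z $ c $ d =
    2 * (if b = c \<and> d = a then 1 else 0) - (if a = b \<and> c = d then 1 else 0)"
  unfolding pauli_x_def pauli_y_def pauli_z_def
  by (cases a; cases b; cases c; cases d) simp_all

lemma sigma_dot_distinct:
  assumes "i \<noteq> k"
  shows "sigma_dot i k = 2 *\<^sub>R swap_op i k - mat 1"
proof -
  have "sigma_dot i k $ s $ t = (2 *\<^sub>R swap_op i k - mat 1) $ s $ t" for s t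
  proof (cases "\<forall>j. j \<noteq> i \<longrightarrow> j \<noteq> k \<longrightarrow> s j = t j")
    case True
    have swap: "t = swap_config i k s \<longleftrightarrow> t i = s k \<and> t k = s i"
    proof
      assume "t i = s k \<and> t k = s i"
      with True show "t = swap_config i k s"
        unfolding swap_config_def by (intro ext) (metis fun_upd_apply)
    qed (use assms in \<open>simp add: swap_config_def\<close>)
    have same: "s = t \<longleftrightarrow> s i = t i \<and> s k = t k"
      using True by (auto simp: fun_eq_iff)
    have "sigma_dot i k $ s $ t =
        2 * (if t i = s k \<and> t k = s i then 1 else 0) - (if s i = t i \<and> s k = t k then 1 else 0)"
      unfolding sigma_dot_def vector_add_component two_site_op_entry[OF assms] if_P[OF True]
      by (rule pauli_exchange)
    also have "\<dots> = (2 *\<^sub>R swap_op i k - mat 1) $ s $ t"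
      by (simp only: swap_op_def mat_def vector_minus_component vector_scaleR_component
          vec_lambda_beta swap same scaleR_conv_of_real[where 'a = complex] of_real_numeral)
    finally show ?thesis .
  next
    case False
    then have "t \<noteq> swap_config i k s" "s \<noteq> t" by (auto simp: swap_config_def)
    then show ?thesis
      unfolding sigma_dot_def vector_add_component two_site_op_entry[OF assms] if_not_P[OF False]
      by (simp add: swap_op_def mat_def)
  qed
  then show ?thesis unfolding vec_eq_iff by blast
qed

section \<open>Total spin and energy in terms of exchanges\<close>

lemma total_spin_mult:
  "total_spin P ** total_spin P = (1/4) *\<^sub>R (\<Sum>i\<in>UNIV. \<Sum>k\<in>UNIV. site_op i P ** site_op k P)"
proof -
  have "(\<Sum>u\<in>UNIV. (\<Sum>i\<in>UNIV. (1/2) *\<^sub>R site_op i P $ s $ u) * (\<Sum>k\<in>UNIV. (1/2) *\<^sub>R site_op k P $ u $ t)) =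
      (1/4) *\<^sub>R (\<Sum>i\<in>UNIV. \<Sum>k\<in>UNIV. \<Sum>u\<in>UNIV. site_op i P $ s $ u * site_op k P $ u $ t)"
    for s t :: "'a \<Rightarrow> bool"
  proof -
    have "(\<Sum>u\<in>UNIV. (\<Sum>i\<in>UNIV. (1/2) *\<^sub>R site_op i P $ s $ u) * (\<Sum>k\<in>UNIV. (1/2) *\<^sub>R site_op k P $ u $ t)) =
      (\<Sum>u\<in>UNIV. \<Sum>i\<in>UNIV. \<Sum>k\<in>UNIV. (1/4) *\<^sub>R (site_op i P $ s $ u * site_op k P $ u $ t))"
      by (simp add: sum_product)
    also have "\<dots> = (\<Sum>i\<in>UNIV. \<Sum>u\<in>UNIV. \<Sum>k\<in>UNIV. (1/4) *\<^sub>R (site_op i P $ s $ u * site_op k P $ u $ t))"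
      by (rule sum.swap)
    also have "\<dots> = (\<Sum>i\<in>UNIV. \<Sum>k\<in>UNIV. \<Sum>u\<in>UNIV. (1/4) *\<^sub>R (site_op i P $ s $ u * site_op k P $ u $ t))"
      by (intro sum.cong refl) (rule sum.swap)
    finally show ?thesis by (simp add: scaleR_sum_right)
  qed
  then show ?thesis
    by (simp add: vec_eq_iff total_spin_def matrix_matrix_mult_def)
qed

lemma total_spin_sq_eq:
  "total_spin_sq = (1/4) *\<^sub>R (\<Sum>i\<in>UNIV. \<Sum>k\<in>UNIV. sigma_dot i k)"
  by (simp add: total_spin_sq_def total_spin_mult sigma_dot_def sum.distrib scaleR_add_right)

text \<open>With S the sum of all exchanges, the squared total spin is (2 S - N^2 + 2 N) / 4.
  Subtracting it from (N^2 + 2 N) / 4 cancels the linear terms and leaves (N^2 - S) / 2.\<close>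

lemma Delta_S_sq_eq:
  "(Delta_S_sq :: ('v::finite) op) = (1/2) *\<^sub>R (\<Sum>i\<in>UNIV. \<Sum>k\<in>UNIV. mat 1 - swap_op i k)"
proof -
  let ?N = "real CARD('v)" and ?I = "mat 1 :: 'v op"
  define S where "S = (\<Sum>i\<in>UNIV. \<Sum>k\<in>UNIV. (swap_op i k :: 'v op))"
  \<comment> \<open>For \<open>k = i\<close> the exchange formula would give I instead of 3 I; the
    last term supplies the missing 2 I.\<close>
  have "sigma_dot i k = 2 *\<^sub>R swap_op i k - ?I + (if k = i then 2 *\<^sub>R ?I else 0)" for i k
    by (cases "k = i") (auto simp: sigma_dot_same sigma_dot_distinct vec_eq_iff mat_def scaleR_conv_of_real[where 'a = complex])
  moreover have all: "(\<Sum>i\<in>(UNIV :: 'v set). \<Sum>k\<in>(UNIV :: 'v set). ?I) = (?N * ?N) *\<^sub>R ?I"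
    by (simp add: sum_constant_scaleR del: sum_constant)
  moreover have "(\<Sum>i\<in>(UNIV :: 'v set). \<Sum>k\<in>UNIV. if k = i then 2 *\<^sub>R ?I else 0) = (2 * ?N) *\<^sub>R ?I"
    by (simp add: sum_constant_scaleR mult.commute del: sum_constant)
  ultimately have "(\<Sum>i\<in>UNIV. \<Sum>k\<in>UNIV. sigma_dot i k) = 2 *\<^sub>R S - (?N * ?N) *\<^sub>R ?I + (2 * ?N) *\<^sub>R ?I"
    by (simp only: S_def sum.distrib sum_subtractf scaleR_sum_right)
  moreover have "(\<Sum>i\<in>UNIV. \<Sum>k\<in>UNIV. mat 1 - (swap_op i k :: 'v op)) = (?N * ?N) *\<^sub>R ?I - S"
    by (simp only: S_def sum_subtractf all)
  ultimately show ?thesis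
    by (simp only: Delta_S_sq_def total_spin_sq_eq)
      (simp add: vec_eq_iff field_simps scaleR_conv_of_real[where 'a = complex])
qed

text \<open>The half undoes the factor 2 in 2 P - I, so that an edge contributes I - P.\<close>

definition edge_gap :: "'v set \<Rightarrow> ('v::finite) op" where
  "edge_gap e = (1/2) *\<^sub>R (mat 1 - edge_op e)"

lemma edge_gap_eq: "i \<noteq> k \<Longrightarrow> edge_gap {i, k} = mat 1 - swap_op i k"
  by (simp add: edge_gap_def edge_op_eq sigma_dot_distinct vec_eq_iff scaleR_conv_of_real[where 'a = complex] field_simps)

lemma Delta_H_eq:
  assumes "J \<noteq> 0"
  shows "(1 / (4 * J)) *\<^sub>R Delta_H J E = (1/2) *\<^sub>R (\<Sum>e\<in>E. edge_gap (e :: 'v::finite set))"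
proof -
  have "Delta_H J E = J *\<^sub>R (\<Sum>e\<in>E. mat 1 - edge_op e)"
    by (simp add: Delta_H_def heisenberg_def E_star_def sum_subtractf sum_constant_scaleR
        scaleR_diff_right del: sum_constant)
  then show ?thesis
    using assms by (simp add: edge_gap_def flip: scaleR_sum_right)
qed

section \<open>Quadratic forms and Hermitian operators\<close>

definition quad_form :: "complex ^ 'n ^ 'n \<Rightarrow> complex ^ 'n \<Rightarrow> real" where
  "quad_form A v = Re (\<Sum>s\<in>UNIV. cnj (v $ s) * (A *v v) $ s)"

lemma quad_form_diff: "quad_form (A - B) v = quad_form A v - quad_form B v"
  by (simp add: quad_form_def matrix_vector_mult_diff_rdistrib right_diff_distrib sum_subtractf)

lemma quad_form_add: "quad_form (A + B) v = quad_form A v + quad_form B v"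
  by (simp add: quad_form_def matrix_vector_mult_add_rdistrib distrib_left sum.distrib)

lemma quad_form_scaleR: "quad_form (c *\<^sub>R A) v = c * quad_form A v"
proof -
  have "((c *\<^sub>R A) *v v) $ s = c *\<^sub>R (A *v v) $ s" for s
    by (simp add: matrix_vector_mult_def scaleR_sum_right)
  then have "(\<Sum>s\<in>UNIV. cnj (v $ s) * ((c *\<^sub>R A) *v v) $ s) =
      c *\<^sub>R (\<Sum>s\<in>UNIV. cnj (v $ s) * (A *v v) $ s)"
    by (simp only: scaleR_sum_right mult_scaleR_right)
  then show ?thesis by (simp only: quad_form_def scaleR_complex.sel)
qed

lemma quad_form_sum: "quad_form (\<Sum>x\<in>X. A x) v = (\<Sum>x\<in>X. quad_form (A x) v)"
proof -
  have "quad_form 0 v = 0" by (simp add: quad_form_def)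
  then show ?thesis
    by (induction X rule: infinite_finite_induct) (simp_all add: quad_form_add)
qed

lemma hermitian_swap_op: "hermitian (swap_op i k)"
proof -
  have "t = swap_config i k s \<longleftrightarrow> s = swap_config i k t" for s t :: "'a \<Rightarrow> bool"
    by auto
  then show ?thesis by (simp add: hermitian_def swap_op_def)
qed

lemma hermitian_mat_1: "hermitian (mat 1)"
  by (simp add: hermitian_def mat_def)

lemma hermitian_diff:
  assumes "hermitian A" "hermitian B"
  shows "hermitian (A - B)"
  using assms unfolding hermitian_def vector_minus_component complex_cnj_diff
  by (intro allI arg_cong2[of _ _ _ _ minus]) blast+

lemma hermitian_scaleR:
  assumes "hermitian A"
  shows "hermitian (c *\<^sub>R A)"
  using assms unfolding hermitian_def vector_scaleR_component complex_cnj_scaleR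
  by (intro allI arg_cong[of _ _ "scaleR c"]) blast

lemma hermitian_sum:
  assumes "\<And>x. x \<in> X \<Longrightarrow> hermitian (A x)"
  shows "hermitian (\<Sum>x\<in>X. A x)"
  using assms unfolding hermitian_def sum_component cnj_sum
  by (intro allI sum.cong) blast+

section \<open>The exchange pseudometric\<close>

definition swap_dist :: "complex ^ ('v \<Rightarrow> bool) \<Rightarrow> 'v \<Rightarrow> ('v::finite) \<Rightarrow> real" where
  "swap_dist v i k = L2_set (\<lambda>s. cmod (v $ s - v $ swap_config i k s)) UNIV"

lemma swap_dist_square:
  "(swap_dist v i k)\<^sup>2 = (\<Sum>s\<in>UNIV. (cmod (v $ s - v $ swap_config i k s))\<^sup>2)"
  by (simp add: swap_dist_def L2_set_def sum_nonneg)

lemma swap_dist_nonneg: "0 \<le> swap_dist v i k"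
  by (simp add: swap_dist_def L2_set_nonneg)

lemma swap_dist_same [simp]: "swap_dist v i i = 0"
  by (simp add: swap_dist_def L2_set_def)

lemma swap_dist_commute: "swap_dist v i k = swap_dist v k i"
  by (simp add: swap_dist_def swap_config_commute)

text \<open>Permuting coordinates preserves the norm, so |v - P v|^2 = 2 |v|^2 - 2 Re <v, P
  v>.\<close>

lemma quad_form_swap_op: "quad_form (mat 1 - swap_op i k) v = (swap_dist v i k)\<^sup>2 / 2"
proof -
  let ?w = "\<lambda>s. v $ swap_config i k s"
  have "(\<Sum>s\<in>UNIV. (cmod (?w s))\<^sup>2) = (\<Sum>s\<in>UNIV. (cmod (v $ s))\<^sup>2)"
    by (rule sum.reindex_bij_betw[OF bij_swap_config])
  moreover have "(cmod (a - b))\<^sup>2 = (cmod a)\<^sup>2 + (cmod b)\<^sup>2 - 2 * Re (cnj a * b)" for a b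
    unfolding cmod_power2 by (simp add: power2_eq_square algebra_simps)
  ultimately have "(swap_dist v i k)\<^sup>2 =
      2 * (\<Sum>s\<in>UNIV. (cmod (v $ s))\<^sup>2 - Re (cnj (v $ s) * ?w s))"
    by (simp add: swap_dist_square sum.distrib sum_subtractf sum_distrib_left)
  moreover have "(cmod a)\<^sup>2 = Re (cnj a * a)" for a
    unfolding cmod_power2 by (simp add: power2_eq_square)
  ultimately show ?thesis
    by (simp add: quad_form_def matrix_vector_mult_diff_rdistrib swap_op_mult_vec
        right_diff_distrib sum_subtractf)
qed

text \<open>
  Suppose \<open>s i \<noteq> s k\<close>. As there are only two levels, \<open>s j\<close> agrees with \<open>s k\<close> or with \<open>s i\<close>, so the
  exchange of \<open>i\<close> and \<open>k\<close> is \<open>(i j)\<close> followed by \<open>(j k)\<close> in the first case, and \<open>(j k)\<close> followed by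
  \<open>(i j)\<close> in the second. The \<open>(i j)\<close> steps that arise run exactly once through the configurations
  in which \<open>i\<close> and \<open>j\<close> differ, which is why the norm below does not exceed \<open>swap_dist v i j\<close>.
\<close>

lemma swap_dist_detour:
  assumes distinct: "i \<noteq> j" "j \<noteq> k" "i \<noteq> k"
  shows "L2_set (\<lambda>s. if s i = s k then 0
        else if s j = s k then cmod (v $ s - v $ swap_config i j s)
        else cmod (v $ swap_config j k s - v $ swap_config i j (swap_config j k s))) UNIV =
      swap_dist v i j"
proof -
  let ?D = "\<lambda>s. (cmod (v $ s - v $ swap_config i j s))\<^sup>2"
  let ?A = "{s. s i \<noteq> s k \<and> s j = s k}" and ?B = "{s. s i \<noteq> s k \<and> s j \<noteq> s k}"
  let ?C = "{s. s i \<noteq> s j \<and> s j \<noteq> s k}"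
  have "(\<Sum>s\<in>UNIV. (if s i = s k then 0
        else if s j = s k then cmod (v $ s - v $ swap_config i j s)
        else cmod (v $ swap_config j k s - v $ swap_config i j (swap_config j k s)))\<^sup>2) =
      (\<Sum>s\<in>UNIV. (if s \<in> ?A then ?D s else 0) + (if s \<in> ?B then ?D (swap_config j k s) else 0))"
    by (rule sum.cong) auto
  also have "\<dots> = sum ?D ?A + (\<Sum>s\<in>?B. ?D (swap_config j k s))"
    by (simp add: sum.distrib flip: sum.inter_filter)
  \<comment> \<open>On \<open>?B\<close> the two levels force \<open>s i = s j\<close>, so
    exchanging \<open>j\<close> and \<open>k\<close> carries \<open>?B\<close> bijectively onto
    \<open>?C\<close>. Together \<open>?A\<close> and \<open>?C\<close> are the configurations with
    \<open>s i \<noteq> s j\<close>.\<close>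
  also have "(\<Sum>s\<in>?B. ?D (swap_config j k s)) = sum ?D ?C"
    using distinct
    by (intro sum.reindex_bij_witness[of _ "swap_config j k" "swap_config j k"])
      (auto simp: swap_config_apply)
  also have "sum ?D ?A + sum ?D ?C = sum ?D (?A \<union> ?C)"
    by (rule sum.union_disjoint[symmetric]) auto
  also have "\<dots> = sum ?D UNIV"
  proof (rule sum.mono_neutral_left)
    have "?D s = 0" if "s i = s j" for s
      using that by (simp add: swap_config_eq_self)
    then show "\<forall>s\<in>UNIV - (?A \<union> ?C). ?D s = 0" by blast
  qed auto
  finally show ?thesis
    by (simp add: swap_dist_def L2_set_def)
qed

text \<open>Each coordinate of the difference splits into an \<open>(i j)\<close> step, recorded by
  \<open>?F i k\<close>, and a \<open>(k j)\<close> step, recorded by \<open>?F k i\<close>.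
  Minkowski's inequality separates them, and \<open>swap_dist_detour\<close> evaluates both
  norms.\<close>

lemma swap_dist_triangle: "swap_dist v i k \<le> swap_dist v i j + swap_dist v j k"
proof (cases "i \<noteq> j \<and> j \<noteq> k \<and> i \<noteq> k")
  case True
  let ?F = "\<lambda>i k s. if s i = s k then 0
        else if s j = s k then cmod (v $ s - v $ swap_config i j s)
        else cmod (v $ swap_config j k s - v $ swap_config i j (swap_config j k s))"
  have "cmod (v $ s - v $ swap_config i k s) \<le> ?F i k s + ?F k i s" for s
  proof -
    \<comment> \<open>The cases are exhaustive because a qubit has only two levels.\<close>
    consider "s i = s k" | "s i \<noteq> s k" "s j = s k" | "s i \<noteq> s k" "s j = s i" by blast
    then show ?thesis
    proof cases
      case 1
      then show ?thesis by (simp add: swap_config_eq_self)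
    next
      case 2
      then have ki: "s k \<noteq> s i" "s j \<noteq> s i" by auto
      have "swap_config k j (swap_config j i s) = swap_config i k s"
        using True 2 by (intro swap_config_detour) auto
      then show ?thesis
        unfolding if_not_P[OF 2(1)] if_P[OF 2(2)] if_not_P[OF ki(1)] if_not_P[OF ki(2)]
          swap_config_commute[of i j]
        using norm_triangle_ineq[of "v $ s - v $ swap_config j i s"
            "v $ swap_config j i s - v $ swap_config i k s"]
        by simp
    next
      case 3
      then have ki: "s k \<noteq> s i" "s j \<noteq> s k" by auto
      have "swap_config i j (swap_config j k s) = swap_config i k s"
        using True 3 swap_config_detour[of k j i s] by (auto simp: swap_config_commute[of k i])
      then show ?thesis
        unfolding if_not_P[OF 3(1)] if_P[OF 3(2)] if_not_P[OF ki(1)] if_not_P[OF ki(2)]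
          swap_config_commute[of k j]
        using norm_triangle_ineq[of "v $ s - v $ swap_config j k s"
            "v $ swap_config j k s - v $ swap_config i k s"]
        by simp
    qed
  qed
  then have "swap_dist v i k \<le> L2_set (\<lambda>s. ?F i k s + ?F k i s) UNIV"
    unfolding swap_dist_def by (intro L2_set_mono) auto
  also have "\<dots> \<le> L2_set (?F i k) UNIV + L2_set (?F k i) UNIV"
    by (rule L2_set_triangle_ineq)
  also have "\<dots> = swap_dist v i j + swap_dist v k j"
    using True by (intro arg_cong2[of _ _ _ _ "(+)"] swap_dist_detour) auto
  finally show ?thesis by (simp add: swap_dist_commute)
qed (auto simp: swap_dist_nonneg)

section \<open>Paths in a connected graph\<close>

text \<open>As no vertex repeats, no edge repeats, so the sum along the path is a sum over a set
  \<open>P\<close> of edges. Confining \<open>\<Union>P\<close> to the vertices of the path shows in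
  the induction that the edge at the new start \<open>x\<close> is not yet in
  \<open>P\<close>.\<close>

lemma distinct_path_bound:
  fixes d :: "'v \<Rightarrow> 'v \<Rightarrow> real" and f :: "'v set \<Rightarrow> real"
  assumes "rtrancl_path (\<lambda>a b. {a, b} \<in> E) x xs y" "distinct (x # xs)"
    and triangle: "\<And>a b c. d a c \<le> d a b + d b c"
    and same: "\<And>a. d a a = 0"
    and edge: "\<And>a b. a \<noteq> b \<Longrightarrow> d a b = f {a, b}"
  shows "\<exists>P\<subseteq>E. finite P \<and> \<Union>P \<subseteq> set (x # xs) \<and> card P \<le> length xs \<and> d x y \<le> sum f P"
  using assms(1,2)
proof (induction rule: rtrancl_path.induct)
  case (base x)
  then show ?case by (intro exI[of _ "{}"]) (simp add: same)
next
  case (step x y ys z)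
  then obtain P where P: "P \<subseteq> E" "finite P" "\<Union>P \<subseteq> set (y # ys)" "card P \<le> length ys" "d y z \<le> sum f P"
    by auto
  moreover have "{x, y} \<notin> P" using P(3) step.prems by auto
  moreover have "d x z \<le> f {x, y} + d y z"
    using triangle[of x z y] edge[of x y] step.prems by auto
  ultimately show ?case using step.hyps
    by (intro exI[of _ "insert {x, y} P"]) auto
qed

lemma connected_graph_dist_bound:
  fixes E :: "('v::finite) set set"
  assumes "connected_graph E"
    and triangle: "\<And>a b c. d a c \<le> d a b + d b c"
    and same: "\<And>a. d a a = (0::real)"
    and nonneg: "\<And>a b. 0 \<le> d a b"
    and edge: "\<And>a b. a \<noteq> b \<Longrightarrow> d a b = f {a, b}"
  shows "(d i k)\<^sup>2 \<le> (real CARD('v) - 1) * (\<Sum>e\<in>E. (f e)\<^sup>2)"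
proof -
  let ?r = "\<lambda>a b. {a, b} \<in> E"
  have "?r\<^sup>*\<^sup>* i k"
    using assms(1) by (simp add: connected_graph_def rtranclp_rtrancl_eq)
  then obtain ys where "rtrancl_path ?r i ys k"
    using rtranclp_eq_rtrancl_path by metis
  then obtain xs where xs: "rtrancl_path ?r i xs k" "distinct (i # xs)"
    by (rule rtrancl_path_distinct)
  obtain P where P: "P \<subseteq> E" "card P \<le> length xs" "d i k \<le> sum f P"
    using distinct_path_bound[OF xs, of d f] triangle same edge by auto
  \<comment> \<open>The list \<open>xs\<close> omits the starting vertex, so its length counts edges
    and is at most N - 1.\<close>
  have "length (i # xs) \<le> CARD('v)"
    using distinct_card[OF xs(2)] card_mono[of UNIV "set (i # xs)"] by simp
  then have card: "real (card P) \<le> real CARD('v) - 1"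
    using P(2) by simp
  have "(d i k)\<^sup>2 \<le> (sum f P)\<^sup>2"
    using P(3) nonneg by (rule power_mono)
  \<comment> \<open>Cauchy-Schwarz against the constant function 1.\<close>
  also have "\<dots> \<le> real (card P) * (\<Sum>e\<in>P. (f e)\<^sup>2)"
    using sum_squared_le_sum_of_squares[of f P] by (simp add: mult.commute)
  also have "\<dots> \<le> (real CARD('v) - 1) * (\<Sum>e\<in>E. (f e)\<^sup>2)"
    using card P(1) by (intro mult_mono sum_mono2 sum_nonneg) auto
  finally show ?thesis .
qed

section \<open>Comparison of the two quadratic forms\<close>

theorem mainTheorem2:
  fixes E :: "'v::finite set set" and J :: real
  assumes "loopless_graph E" and "connected_graph E" and "J \<noteq> 0"
  shows "(Delta_S_sq :: 'v op) \<preceq>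
    (real CARD('v) * (real CARD('v) - 1)\<^sup>2) *\<^sub>R ((1 / (4 * J)) *\<^sub>R Delta_H J E)"
proof -
  let ?N = "real CARD('v)"
  let ?A = "Delta_S_sq :: 'v op"
  let ?B = "(?N * (?N - 1)\<^sup>2) *\<^sub>R ((1 / (4 * J)) *\<^sub>R Delta_H J E)"
  have edge: "\<exists>i k. i \<noteq> k \<and> e = {i, k}" if "e \<in> E" for e
    using assms(1) that by (simp add: loopless_graph_def)
  have herm_gap: "hermitian (edge_gap e)" if "e \<in> E" for e
    using edge[OF that] by (auto simp: edge_gap_eq hermitian_diff hermitian_mat_1 hermitian_swap_op)
  have hermA: "hermitian ?A"
    unfolding Delta_S_sq_eq
    by (intro hermitian_scaleR hermitian_sum hermitian_diff hermitian_mat_1 hermitian_swap_op)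
  have hermB: "hermitian ?B"
    unfolding Delta_H_eq[OF assms(3)] by (intro hermitian_scaleR hermitian_sum herm_gap)
  have "quad_form ?A v \<le> quad_form ?B v" for v
  proof -
    \<comment> \<open>The length of an edge as a function of the unordered pair; the 2 compensates
      the half in \<open>quad_form_swap_op\<close>.\<close>
    define f where "f e = sqrt (2 * quad_form (edge_gap e) v)" for e
    define Q where "Q = (\<Sum>e\<in>E. (f e)\<^sup>2)"
    have f: "swap_dist v i k = f {i, k}" if "i \<noteq> k" for i k
      using that swap_dist_nonneg[of v i k] by (simp add: f_def edge_gap_eq quad_form_swap_op)
    have gap: "quad_form (edge_gap e) v = (f e)\<^sup>2 / 2" if "e \<in> E" for e
      using edge[OF that] by (auto simp: edge_gap_eq quad_form_swap_op f)
    have bound: "(swap_dist v i k)\<^sup>2 \<le> (?N - 1) * Q" for i k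
      unfolding Q_def
      by (rule connected_graph_dist_bound[OF assms(2)])
        (simp_all add: swap_dist_triangle swap_dist_nonneg f)
    \<comment> \<open>One factor N - 1 counts the \<open>k\<close> other than \<open>i\<close>, the
      other comes from the path bound.\<close>
    have row: "(\<Sum>k\<in>UNIV. (swap_dist v i k)\<^sup>2) \<le> (?N - 1) * ((?N - 1) * Q)" for i
    proof -
      have "(\<Sum>k\<in>UNIV. (swap_dist v i k)\<^sup>2) = (\<Sum>k\<in>UNIV - {i}. (swap_dist v i k)\<^sup>2)"
        by (rule sum.mono_neutral_right) auto
      also have "\<dots> \<le> real (card (UNIV - {i})) * ((?N - 1) * Q)"
        using bound by (rule sum_bounded_above)
      finally show ?thesis by (simp add: card_Diff_singleton of_nat_diff Suc_leI)
    qed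
    \<comment> \<open>The 4 combines the halves of \<open>Delta_S_sq_eq\<close> and
      \<open>quad_form_swap_op\<close>; the same 1/4 arises from \<open>Delta_H_eq\<close> and
      \<open>gap\<close>.\<close>
    have "quad_form ?A v = (\<Sum>i\<in>UNIV. \<Sum>k\<in>UNIV. (swap_dist v i k)\<^sup>2) / 4"
      by (simp add: Delta_S_sq_eq quad_form_scaleR quad_form_sum quad_form_swap_op
          flip: sum_divide_distrib)
    also have "\<dots> \<le> (\<Sum>i\<in>(UNIV :: 'v set). (?N - 1) * ((?N - 1) * Q)) / 4"
      by (intro divide_right_mono sum_mono row) simp
    also have "\<dots> = quad_form ?B v"
      by (simp add: Delta_H_eq[OF assms(3)] quad_form_scaleR quad_form_sum gap Q_def
          power2_eq_square flip: sum_divide_distrib)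
    finally show ?thesis .
  qed
  then have "0 \<le> quad_form (?B - ?A) v" for v
    by (simp only: quad_form_diff diff_ge_0_iff_ge)
  then show ?thesis
    using hermA hermB hermitian_diff[OF hermB hermA]
    unfolding op_le_def pos_semidef_def quad_form_def[symmetric] by blast
qed

end
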